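(* The center of the algebra $AW(3,Q_0)$ consists of the scalars (i.e. equals $\mathbb C\cdot 1$).
   Context: All algebras are associative unital algebras over $\mathbb C$. Parameters: $q,a,b,c,d\in\mathbb C$ with $q\ne0$, $q^m\ne1$ for $m=1,2,\ldots$; $a,b,c,d\ne0$; $abcd\ne q^{-m}$ for $m=0,1,2,\ldots$; and $ab\ne1$. Let $e_1=a+b+c+d$, $e_2=ab+ac+bc+ad+bd+cd$, $e_3=abc+abd+acd+bcd$, $e_4=abcd$. Structure constants: $B=(1-q^{-1})^2(e_3+qe_1)$, $C_0=(q-q^{-1})^2$, $C_1=q^{-1}(q-q^{-1})^2e_4$, $D_0=-q^{-3}(1-q)^2(1+q)(e_4+qe_2+q^2)$, $D_1=-q^{-3}(1-q)^2(1+q)(e_1e_4+qe_3)$, $$Q_0=q^{-4}(1-q)^2\bigl(q^4(e_4-e_2)+q^3(e_1^2-e_1e_3-2e_2)-q^2(e_2e_4+2e_4+e_2)+q(e_3^2-2e_2e_4-e_1e_3)+e_4(1-e_2)\bigr).$$ The algebra $AW(3,Q_0)$ is generated by $K_0,K_1$ with relations $$(q+q^{-1})K_1K_0K_1-K_1^2K_0-K_0K_1^2=BK_1+C_0K_0+D_0,$$ $$(q+q^{-1})K_0K_1K_0-K_0^2K_1-K_1K_0^2=BK_0+C_1K_1+D_1,$$ and $Q=Q_0$, where $$Q=K_1K_0K_1K_0-(q^2+1+q^{-2})K_0K_1K_0K_1+(q+q^{-1})K_0^2K_1^2+(q+q^{-1})(C_0K_0^2+C_1K_1^2)$$ $$+B\bigl((q+1+q^{-1})K_0K_1+K_1K_0\bigr)+(q+1+q^{-1})(D_0K_0+D_1K_1).$$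 *)

theory Defs
  imports
    Complex_Main
    "HOL-Library.Poly_Mapping"
    "HOL-Algebra.QuotRing"
begin

text \<open>
  The free monoid, written additively because the convolution product of
  \<^theory>\<open>HOL-Library.Poly_Mapping\<close> is indexed by a \<^class>\<open>monoid_add\<close>.  The library's product
  on \<open>'g fword \<Rightarrow>\<^sub>0 complex\<close> is then the product of the free associative unital
  complex algebra on the set \<open>'g\<close>.
\<close>

datatype 'g fword = FWord "'g list"

instantiation fword :: (type) monoid_add
begin

definition zero_fword :: "'a fword" where
  "0 = FWord []"

fun plus_fword :: "'a fword \<Rightarrow> 'a fword \<Rightarrow> 'a fword" where
  "FWord u + FWord v = FWord (u @ v)"

instance
proof
  fix u v w :: "'a fword"
  show "u + v + w = u + (v + w)"
    by (cases u; cases v; cases w) simp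
  show "0 + u = u"
    by (cases u) (simp add: zero_fword_def)
  show "u + 0 = u"
    by (cases u) (simp add: zero_fword_def)
qed

end

datatype gen = G0 | G1

type_synonym free_alg = "gen fword \<Rightarrow>\<^sub>0 complex"

definition K0 :: free_alg where
  "K0 = Poly_Mapping.single (FWord [G0]) 1"

definition K1 :: free_alg where
  "K1 = Poly_Mapping.single (FWord [G1]) 1"

definition cst :: "complex \<Rightarrow> free_alg" where
  "cst z = Poly_Mapping.single 0 z"

lemma cst_1: "cst 1 = 1"
  by (simp add: cst_def)

lemma cst_add: "cst (x + y) = cst x + cst y"
  by (simp add: cst_def single_add)

lemma cst_mult: "cst (x * y) = cst x * cst y"
  by (simp add: cst_def mult_single)

lemma cst_central: "cst z * x = x * cst z"
proof (induction x rule: update_induct)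
  case const
  then show ?case by simp
next
  case (update p k v)
  have "Poly_Mapping.update k v p = p + Poly_Mapping.single k v"
    using update(1) by (intro poly_mapping_eqI)
      (auto simp: lookup_update lookup_add lookup_single in_keys_iff when_def)
  moreover have "cst z * Poly_Mapping.single k v = Poly_Mapping.single k v * cst z"
    by (simp add: cst_def mult_single mult.commute)
  ultimately show ?case
    using update(3) by (simp add: distrib_left distrib_right)
qed

definition free_ring :: "free_alg ring" where
  "free_ring = \<lparr>carrier = UNIV, mult = (*), one = 1, zero = 0, add = (+)\<rparr>"

lemma ring_free_ring: "ring free_ring"
proof (rule ringI)
  show "abelian_group free_ring"
  proof (rule abelian_groupI)
    fix x assume "x \<in> carrier free_ring"
    have "- x + x = 0" by simp
    then show "\<exists>y\<in>carrier free_ring. y \<oplus>\<^bsub>free_ring\<^esub> x = \<zero>\<^bsub>free_ring\<^esub>"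
      unfolding free_ring_def by (auto intro!: exI[of _ "- x"])
  qed (auto simp: free_ring_def add.assoc add.commute)
  show "Group.monoid free_ring"
    by (rule monoidI) (auto simp: free_ring_def mult.assoc)
qed (auto simp: free_ring_def distrib_left distrib_right)

definition e1 :: "complex \<Rightarrow> complex \<Rightarrow> complex \<Rightarrow> complex \<Rightarrow> complex" where
  "e1 a b c d = a + b + c + d"

definition e2 :: "complex \<Rightarrow> complex \<Rightarrow> complex \<Rightarrow> complex \<Rightarrow> complex" where
  "e2 a b c d = a*b + a*c + b*c + a*d + b*d + c*d"

definition e3 :: "complex \<Rightarrow> complex \<Rightarrow> complex \<Rightarrow> complex \<Rightarrow> complex" where
  "e3 a b c d = a*b*c + a*b*d + a*c*d + b*c*d"

definition e4 :: "complex \<Rightarrow> complex \<Rightarrow> complex \<Rightarrow> complex \<Rightarrow> complex" where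
  "e4 a b c d = a*b*c*d"

definition aw_B :: "complex \<Rightarrow> complex \<Rightarrow> complex \<Rightarrow> complex \<Rightarrow> complex \<Rightarrow> complex" where
  "aw_B q a b c d = (1 - inverse q)^2 * (e3 a b c d + q * e1 a b c d)"

definition aw_C0 :: "complex \<Rightarrow> complex" where
  "aw_C0 q = (q - inverse q)^2"

definition aw_C1 :: "complex \<Rightarrow> complex \<Rightarrow> complex \<Rightarrow> complex \<Rightarrow> complex \<Rightarrow> complex" where
  "aw_C1 q a b c d = inverse q * (q - inverse q)^2 * e4 a b c d"

definition aw_D0 :: "complex \<Rightarrow> complex \<Rightarrow> complex \<Rightarrow> complex \<Rightarrow> complex \<Rightarrow> complex" where
  "aw_D0 q a b c d =
     - (inverse q ^ 3 * (1 - q)^2 * (1 + q) * (e4 a b c d + q * e2 a b c d + q^2))"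

definition aw_D1 :: "complex \<Rightarrow> complex \<Rightarrow> complex \<Rightarrow> complex \<Rightarrow> complex \<Rightarrow> complex" where
  "aw_D1 q a b c d =
     - (inverse q ^ 3 * (1 - q)^2 * (1 + q) * (e1 a b c d * e4 a b c d + q * e3 a b c d))"

definition aw_Q0 :: "complex \<Rightarrow> complex \<Rightarrow> complex \<Rightarrow> complex \<Rightarrow> complex \<Rightarrow> complex" where
  "aw_Q0 q a b c d =
    (let s1 = e1 a b c d; s2 = e2 a b c d; s3 = e3 a b c d; s4 = e4 a b c d in
     inverse q ^ 4 * (1 - q)^2 *
       (q^4 * (s4 - s2)
        + q^3 * (s1^2 - s1 * s3 - 2 * s2)
        - q^2 * (s2 * s4 + 2 * s4 + s2)
        + q * (s3^2 - 2 * s2 * s4 - s1 * s3)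
        + s4 * (1 - s2)))"

definition aw_rel0 :: "complex \<Rightarrow> complex \<Rightarrow> complex \<Rightarrow> complex \<Rightarrow> complex \<Rightarrow> free_alg" where
  "aw_rel0 q a b c d =
     (cst (q + inverse q) * K1 * K0 * K1 - K1^2 * K0 - K0 * K1^2)
     - (cst (aw_B q a b c d) * K1 + cst (aw_C0 q) * K0 + cst (aw_D0 q a b c d))"

definition aw_rel1 :: "complex \<Rightarrow> complex \<Rightarrow> complex \<Rightarrow> complex \<Rightarrow> complex \<Rightarrow> free_alg" where
  "aw_rel1 q a b c d =
     (cst (q + inverse q) * K0 * K1 * K0 - K0^2 * K1 - K1 * K0^2)
     - (cst (aw_B q a b c d) * K0 + cst (aw_C1 q a b c d) * K1 + cst (aw_D1 q a b c d))"

definition aw_Q :: "complex \<Rightarrow> complex \<Rightarrow> complex \<Rightarrow> complex \<Rightarrow> complex \<Rightarrow> free_alg" where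
  "aw_Q q a b c d =
     K1 * K0 * K1 * K0
     - cst (q^2 + 1 + inverse q ^ 2) * K0 * K1 * K0 * K1
     + cst (q + inverse q) * K0^2 * K1^2
     + cst (q + inverse q) * (cst (aw_C0 q) * K0^2 + cst (aw_C1 q a b c d) * K1^2)
     + cst (aw_B q a b c d) * (cst (q + 1 + inverse q) * K0 * K1 + K1 * K0)
     + cst (q + 1 + inverse q) * (cst (aw_D0 q a b c d) * K0 + cst (aw_D1 q a b c d) * K1)"

definition aw_ideal :: "complex \<Rightarrow> complex \<Rightarrow> complex \<Rightarrow> complex \<Rightarrow> complex \<Rightarrow> free_alg set" where
  "aw_ideal q a b c d =
     Idl\<^bsub>free_ring\<^esub> {aw_rel0 q a b c d, aw_rel1 q a b c d,
                     aw_Q q a b c d - cst (aw_Q0 q a b c d)}"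

definition AW :: "complex \<Rightarrow> complex \<Rightarrow> complex \<Rightarrow> complex \<Rightarrow> complex \<Rightarrow> free_alg set ring" where
  "AW q a b c d = free_ring Quot (aw_ideal q a b c d)"

text \<open>The structure map \<open>\<lambda> \<mapsto> \<lambda> \<cdot> 1\<close> of the complex algebra \<^const>\<open>AW\<close>.\<close>

definition aw_scalar ::
    "complex \<Rightarrow> complex \<Rightarrow> complex \<Rightarrow> complex \<Rightarrow> complex \<Rightarrow> complex \<Rightarrow> free_alg set" where
  "aw_scalar q a b c d z = aw_ideal q a b c d +>\<^bsub>free_ring\<^esub> cst z"

definition ring_center :: "('a, 'b) ring_scheme \<Rightarrow> 'a set" where
  "ring_center R = {z \<in> carrier R. \<forall>x \<in> carrier R. z \<otimes>\<^bsub>R\<^esub> x = x \<otimes>\<^bsub>R\<^esub> z}"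

lemma ideal_aw_ideal: "ideal (aw_ideal q a b c d) free_ring"
  unfolding aw_ideal_def
  by (rule ring.genideal_ideal[OF ring_free_ring]) (simp add: free_ring_def)

lemma ring_AW: "ring (AW q a b c d)"
  unfolding AW_def by (rule ideal.quotient_is_ring[OF ideal_aw_ideal])

lemma aw_scalar_1: "aw_scalar q a b c d 1 = \<one>\<^bsub>AW q a b c d\<^esub>"
  by (simp add: aw_scalar_def AW_def FactRing_def cst_1) (simp add: free_ring_def)

end

(*
  AW(3, Q_0) acts on the polynomials in z + 1/z, with K_1 as multiplication and K_0 as the
  Askey--Wilson operator; in the basis (az, a/z; q)_k both operators are bidiagonal. The relations
  reduce every element to a combination of K_0^n K_1^m and K_0^n K_1 K_0 K_1^m, and comparing
  leading coefficients, which are Laurent polynomials in y = q^k, shows that these act linearly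
  independently. So the action is faithful. A central element commutes with K_0, whose eigenvalues
  are distinct, and hence maps 1 to a multiple mu of itself; since it also commutes with K_1 and 1
  generates the module under K_1, it acts as the scalar mu and is equal to mu by faithfulness.
*)

theory Submission
  imports Defs "HOL-Computational_Algebra.Polynomial"
begin

text \<open>Reduces statements additive in an element of the free algebra to multiples of single
  words. Zero is covered as a single word with coefficient 0.\<close>

lemma poly_mapping_additive_induct [case_names single add]:
  fixes x :: "'a \<Rightarrow>\<^sub>0 'b::comm_monoid_add"
  assumes single: "\<And>w c. P (Poly_Mapping.single w c)"
    and add: "\<And>x y. P x \<Longrightarrow> P y \<Longrightarrow> P (x + y)"
  shows "P x"
proof (induction x rule: update_induct)
  case const
  then show ?case using single[of undefined 0] by simp
next
  case (update p k v)
  have "Poly_Mapping.update k v p = p + Poly_Mapping.single k v"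
    using update(1) by (intro poly_mapping_eqI)
      (auto simp: lookup_update lookup_add lookup_single in_keys_iff when_def)
  then show ?case using update(3) single add by metis
qed

section \<open>Laurent polynomials and independence of leading coefficients\<close>

text \<open>Laurent polynomials as functions on the nonzero numbers, where a power of
  \<open>y\<close> clears the denominators; the value at 0 is left free.\<close>

definition laurent_like :: "(complex \<Rightarrow> complex) \<Rightarrow> bool" where
  "laurent_like f \<longleftrightarrow> (\<exists>N h. \<forall>y. y \<noteq> 0 \<longrightarrow> f y * y ^ N = poly h y)"

lemma laurent_likeI: "(\<And>y. y \<noteq> 0 \<Longrightarrow> f y * y ^ N = poly h y) \<Longrightarrow> laurent_like f"
  unfolding laurent_like_def by blast

lemma laurent_like_const: "laurent_like (\<lambda>y. c)"
  by (rule laurent_likeI[where N = 0 and h = "[:c:]"]) simp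

lemma laurent_like_ident: "laurent_like (\<lambda>y. y)"
  by (rule laurent_likeI[where N = 0 and h = "[:0, 1:]"]) simp

lemma laurent_like_inverse: "laurent_like (\<lambda>y. 1 / y)"
  by (rule laurent_likeI[where N = 1 and h = 1]) simp

lemma laurent_like_mult:
  assumes "laurent_like f" "laurent_like g"
  shows "laurent_like (\<lambda>y. f y * g y)"
proof -
  obtain N h N' h' where "\<And>y. y \<noteq> 0 \<Longrightarrow> f y * y ^ N = poly h y"
    "\<And>y. y \<noteq> 0 \<Longrightarrow> g y * y ^ N' = poly h' y"
    using assms unfolding laurent_like_def by blast
  then have "f y * g y * y ^ (N + N') = poly (h * h') y" if "y \<noteq> 0" for y
    using that unfolding power_add poly_mult by (metis mult.assoc mult.left_commute)
  then show ?thesis by (rule laurent_likeI)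
qed

lemma laurent_like_add:
  assumes "laurent_like f" "laurent_like g"
  shows "laurent_like (\<lambda>y. f y + g y)"
proof -
  obtain N h N' h' where *: "\<And>y. y \<noteq> 0 \<Longrightarrow> f y * y ^ N = poly h y"
    "\<And>y. y \<noteq> 0 \<Longrightarrow> g y * y ^ N' = poly h' y"
    using assms unfolding laurent_like_def by blast
  have "(f y + g y) * y ^ (N + N') = poly (h * monom 1 N' + h' * monom 1 N) y" if "y \<noteq> 0" for y
    using *[OF that, symmetric] by (simp add: poly_monom power_add algebra_simps)
  then show ?thesis by (rule laurent_likeI)
qed

lemma laurent_like_poly:
  assumes "laurent_like f"
  shows "laurent_like (\<lambda>y. poly p (f y))"
  by (induction p) (simp_all add: assms laurent_like_const laurent_like_add laurent_like_mult)

text \<open>Once denominators are cleared, a polynomial with infinitely many roots is zero. An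
  identity known only at powers of \<open>q\<close> thereby extends to all nonzero \<open>y\<close>,
  which permits substitutions.\<close>

lemma laurent_like_eq_0:
  assumes "laurent_like f" "infinite Y" "\<And>y. y \<in> Y \<Longrightarrow> y \<noteq> 0 \<and> f y = 0" "y \<noteq> 0"
  shows "f y = 0"
proof -
  obtain N h where h: "\<And>y. y \<noteq> 0 \<Longrightarrow> f y * y ^ N = poly h y"
    using assms(1) unfolding laurent_like_def by blast
  have "Y \<subseteq> {y. poly h y = 0}"
    using assms(3) h by fastforce
  then have "h = 0"
    using assms(2) poly_roots_finite finite_subset by blast
  then show ?thesis using h[OF assms(4)] assms(4) by simp
qed

text \<open>The substitution \<open>y \<mapsto> 1 / (e * y)\<close> fixes \<open>1 / y + e * y\<close> but not \<open>q / y + e * y / q\<close>.\<close>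

lemma poly_pair_eq_0:
  fixes p r :: "complex poly"
  assumes Y: "infinite Y" "0 \<notin> Y" and nz: "e \<noteq> 0" "q \<noteq> 0" "q\<^sup>2 \<noteq> 1"
    and zero: "\<And>y. y \<in> Y \<Longrightarrow>
      poly p (1 / y + e * y) + poly r (1 / y + e * y) * (q / y + e * y / q) = 0"
  shows "p = 0 \<and> r = 0"
proof -
  have t: "laurent_like (\<lambda>y. 1 / y + e * y)"
    by (intro laurent_like_add laurent_like_mult laurent_like_const laurent_like_ident laurent_like_inverse)
  have s: "laurent_like (\<lambda>y. q * (1 / y) + e / q * y)"
    by (intro laurent_like_add laurent_like_mult laurent_like_const laurent_like_ident laurent_like_inverse)
  have F: "poly p (1 / y + e * y) + poly r (1 / y + e * y) * (q * (1 / y) + e / q * y) = 0"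
    if "y \<noteq> 0" for y
  proof (rule laurent_like_eq_0[where Y = Y, OF _ Y(1) _ that])
    show "laurent_like (\<lambda>y. poly p (1 / y + e * y) + poly r (1 / y + e * y) * (q * (1 / y) + e / q * y))"
      by (intro laurent_like_add laurent_like_mult[OF _ s] laurent_like_poly t)
  qed (use Y(2) zero in auto)
  \<comment> \<open>Subtracting the identities at \<open>y\<close> and \<open>1 / (e * y)\<close>
    cancels \<open>p\<close> and leaves \<open>r\<close> times \<open>s - s'\<close>, a nonzero
    multiple of \<open>1 / y - e * y\<close>.\<close>
  have R: "poly r (1 / y + e * y) * (1 / y + (- e) * y) = 0" if "y \<noteq> 0" for y
  proof -
    define t s s' where "t = 1 / y + e * y" and "s = q * (1 / y) + e / q * y"
      and "s' = q * (e * y) + 1 / q * (1 / y)"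
    have "1 / (1 / (e * y)) + e * (1 / (e * y)) = t"
      "q * (1 / (1 / (e * y))) + e / q * (1 / (e * y)) = s'"
      using that nz by (simp_all add: t_def s'_def field_simps)
    moreover have "1 / (e * y) \<noteq> 0"
      using that nz by simp
    ultimately have "poly p t + poly r t * s' = 0"
      using F[of "1 / (e * y)"] by simp
    moreover have "poly p t + poly r t * s = 0"
      using F[OF that] unfolding t_def s_def .
    ultimately have eq: "poly p t + poly r t * s' = poly p t + poly r t * s" by simp
    then have "poly r t * (s - s') = 0" by auto
    moreover have "s - s' = (q - 1 / q) * (1 / y + (- e) * y)"
      using that nz by (simp add: s_def s'_def field_simps)
    moreover have "q - 1 / q \<noteq> 0"
      using nz by (simp add: field_simps power2_eq_square)
    ultimately show ?thesis by (auto simp: t_def)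
  qed
  have "infinite (- {0 :: complex})"
    by (simp add: infinite_UNIV_char_0 Compl_eq_Diff_UNIV)
  \<comment> \<open>The fibre over \<open>w\<close> consists of roots of a nonzero quadratic, so it
    is finite.\<close>
  have image_inf: "infinite ((\<lambda>y. 1 / y + e * y) ` Z)" if Z: "infinite Z" "0 \<notin> Z" for Z
  proof
    assume "finite ((\<lambda>y. 1 / y + e * y) ` Z)"
    then obtain w where "infinite {y \<in> Z. 1 / y + e * y = w}"
      using Z(1) by (metis (no_types, lifting) pigeonhole_infinite mem_Collect_eq image_eqI Collect_cong)
    moreover have "{y \<in> Z. 1 / y + e * y = w} \<subseteq> {y. poly [:1, - w, e:] y = 0}"
      using Z(2) by (auto simp: field_simps)
    moreover have "finite {y. poly [:1, - w, e:] y = 0}"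
      by (rule poly_roots_finite) simp
    ultimately show False using finite_subset by blast
  qed
  \<comment> \<open>\<open>Z\<close> leaves out the fixed points of the substitution, where
    \<open>R\<close> gives no information on \<open>r\<close>.\<close>
  define Z where "Z = {y. y \<noteq> 0 \<and> 1 / y + (- e) * y \<noteq> 0}"
  have "{y. y \<noteq> 0 \<and> 1 / y + (- e) * y = 0} \<subseteq> {y. poly [:1, 0, - e:] y = 0}"
    by (auto simp: field_simps)
  then have "finite {y. y \<noteq> 0 \<and> 1 / y + (- e) * y = 0}"
    by (rule finite_subset) (rule poly_roots_finite, simp)
  moreover have "- {0} = Z \<union> {y. y \<noteq> 0 \<and> 1 / y + (- e) * y = 0}"
    unfolding Z_def by auto
  ultimately have "infinite Z"
    using \<open>infinite (- {0})\<close> by (metis finite_UnI)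
  moreover have "0 \<notin> Z" unfolding Z_def by simp
  ultimately have "infinite ((\<lambda>y. 1 / y + e * y) ` Z)" by (rule image_inf)
  moreover have "(\<lambda>y. 1 / y + e * y) ` Z \<subseteq> {w. poly r w = 0}"
    using R unfolding Z_def by auto
  ultimately have r: "r = 0"
    using poly_roots_finite finite_subset by blast
  have "(\<lambda>y. 1 / y + e * y) ` Y \<subseteq> {w. poly p w = 0}"
    using zero r by auto
  then have "p = 0"
    using image_inf[OF Y] poly_roots_finite finite_subset by blast
  with r show ?thesis by blast
qed

section \<open>Words, and polynomials in \<open>K0\<close>, inside the free algebra\<close>

fun letters :: "'g fword \<Rightarrow> 'g list" where
  "letters (FWord w) = w"

lemma letters_simps [simp]: "letters 0 = []" "letters (v + w) = letters v @ letters w"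
  by (simp add: zero_fword_def) (cases v; cases w; simp)

text \<open>Horner's rule for substituting \<open>K0\<close>. The map is a ring homomorphism, so a
  normal form can carry commutative polynomials as left coefficients.\<close>

definition eval0 :: "complex poly \<Rightarrow> free_alg" where
  "eval0 p = fold_coeffs (\<lambda>s x. cst s + K0 * x) p 0"

lemma cst_0: "cst 0 = 0"
  by (simp add: cst_def)

lemma cst_uminus: "cst (- s) = - cst s"
  using cst_add[of s "- s"] by (simp add: cst_0 add_eq_0_iff)

lemma cst_left_commute: "x * (cst s * y) = cst s * (x * y)"
  by (metis cst_central mult.assoc)

lemma eval0_0 [simp]: "eval0 0 = 0"
  by (simp add: eval0_def)

lemma eval0_pCons: "eval0 (pCons s p) = cst s + K0 * eval0 p"
  by (cases "s = 0 \<and> p = 0") (auto simp: eval0_def cst_0)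

lemma eval0_smult: "eval0 (smult s p) = cst s * eval0 p"
  by (induction p) (simp_all add: eval0_pCons cst_mult cst_left_commute distrib_left)

lemma eval0_add: "eval0 (p + r) = eval0 p + eval0 r"
  by (induction p r rule: poly_induct2) (simp_all add: eval0_pCons cst_add distrib_left)

lemma eval0_mult: "eval0 (p * r) = eval0 p * eval0 r"
  by (induction p) (simp_all add: eval0_pCons eval0_add eval0_smult distrib_right mult.assoc cst_0)

lemma eval0_const: "eval0 [:s:] = cst s"
  by (simp add: eval0_pCons)

lemma eval0_X: "eval0 [:0, 1:] = K0"
  by (simp add: eval0_pCons cst_0 cst_1)

section \<open>The operators on sequences and the relations they satisfy\<close>

locale askey_wilson_params =
  fixes q a b c d :: complex
  assumes q0: "q \<noteq> 0" and q_root: "\<And>m::nat. m \<ge> 1 \<Longrightarrow> q ^ m \<noteq> 1"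
    and nz: "a \<noteq> 0" "b \<noteq> 0" "c \<noteq> 0" "d \<noteq> 0"
    and e4_nz: "\<And>m::nat. a * b * c * d \<noteq> inverse q ^ m"
begin

text \<open>The matrix entries, with \<open>y = q ^ k\<close>, of the Askey--Wilson operator and of multiplication by
  \<open>z + 1 / z\<close> in the basis \<open>(a * z, a / z; q)\<^sub>k\<close>. Letting \<open>k\<close> run over all integers avoids a
  separate treatment of the boundary; the sequences supported on \<open>k \<ge> 0\<close> are invariant since
  \<open>eta 1 = 0\<close>.\<close>

definition e :: complex where "e = a * b * c * d / q"

definition lam :: "complex \<Rightarrow> complex" where
  "lam y = 1 / y + e * y"

definition eta :: "complex \<Rightarrow> complex" where
  "eta y = - ((1 - y) * (1 - a * b * y / q) * (1 - a * c * y / q) * (1 - a * d * y / q)) / y"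

definition xdiag :: "complex \<Rightarrow> complex" where "xdiag y = 1 / (a * y) + a * y"

definition xoff :: "complex \<Rightarrow> complex" where "xoff y = -1 / (a * y)"

definition D :: "(int \<Rightarrow> complex) \<Rightarrow> int \<Rightarrow> complex" where
  "D f k = lam (q powi k) * f k + eta (q powi (k + 1)) * f (k + 1)"

definition X :: "(int \<Rightarrow> complex) \<Rightarrow> int \<Rightarrow> complex" where
  "X f k = xdiag (q powi k) * f k + xoff (q powi (k - 1)) * f (k - 1)"

text \<open>The basis singles out \<open>a\<close>, while \<open>b\<close>, \<open>c\<close>,
  \<open>d\<close> enter the operators symmetrically. Their elementary symmetric polynomials keep
  the degrees in the identities below small.\<close>

definition s1 :: complex where "s1 = b + c + d"

definition s2 :: complex where "s2 = b * c + b * d + c * d"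

definition s3 :: complex where "s3 = b * c * d"

lemma elementary_symmetric:
  "e1 a b c d = a + s1" "e2 a b c d = a * s1 + s2" "e3 a b c d = a * s2 + s3" "e4 a b c d = a * s3"
  by (simp_all add: e1_def e2_def e3_def e4_def s1_def s2_def s3_def algebra_simps)

lemma e_expand: "e = a * s3 / q"
  by (simp add: e_def s3_def)

lemma eta_expand:
  "eta y = - (1 - y) * (1 - a * s1 * y / q + a\<^sup>2 * s2 * y\<^sup>2 / q\<^sup>2 - a ^ 3 * s3 * y ^ 3 / q ^ 3) / y"
  unfolding eta_def s1_def s2_def s3_def
  using q0 by (cases "y = 0"; simp; simp add: divide_simps; Groebner_Basis.algebra)

lemma q_powi_shift:
  "q powi (k + 1) = q powi k * q" "q powi (k + 2) = q powi k * q\<^sup>2"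
  "q powi (k - 1) = q powi k / q" "q powi (k - 2) = q powi k / q\<^sup>2"
  using q0 by (simp_all add: power_int_add power_int_diff)

text \<open>With \<open>y = q powi k\<close>, every coefficient is rational in \<open>y\<close> and
  only the values of \<open>f\<close> from \<open>k - 2\<close> to \<open>k + 1\<close> enter.
  Clearing denominators leaves a polynomial identity with these values as further
  indeterminates.\<close>

lemma op_rel0:
  "(q + inverse q) * X (D (X f)) k - X (X (D f)) k - D (X (X f)) k
   = (1 - inverse q)\<^sup>2 * (a * s2 + s3 + q * (a + s1)) * X f k + (q - inverse q)\<^sup>2 * D f k
     - (inverse q ^ 3 * (1 - q)\<^sup>2 * (1 + q) * (a * s3 + q * (a * s1 + s2) + q\<^sup>2)) * f k"
proof -
  define y where "y = q powi k"
  have y: "y \<noteq> 0" using q0 by (simp add: y_def)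
  note shift = q_powi_shift[of k, folded y_def] add.commute[of 1 k] add.commute[of 2 k]
  show ?thesis
    apply (simp add: D_def X_def)
    apply (simp add: shift eta_expand flip: y_def)
    apply (simp add: lam_def e_expand xdiag_def xoff_def)
    using y q0 nz(1)
    apply (simp add: divide_simps shift)
    apply Groebner_Basis.algebra
    done
qed

lemma op_rel1:
  "(q + inverse q) * D (X (D f)) k - D (D (X f)) k - X (D (D f)) k
   = (1 - inverse q)\<^sup>2 * (a * s2 + s3 + q * (a + s1)) * D f k
     + inverse q * (q - inverse q)\<^sup>2 * (a * s3) * X f k
     - (inverse q ^ 3 * (1 - q)\<^sup>2 * (1 + q) * ((a + s1) * (a * s3) + q * (a * s2 + s3))) * f k"
proof -
  define y where "y = q powi k"
  have y: "y \<noteq> 0" using q0 by (simp add: y_def)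
  note shift = q_powi_shift[of k, folded y_def] add.commute[of 1 k] add.commute[of 2 k]
  show ?thesis
    apply (simp add: D_def X_def)
    apply (simp add: shift eta_expand flip: y_def)
    apply (simp add: lam_def e_expand xdiag_def xoff_def)
    using y q0 nz(1)
    apply (simp add: divide_simps shift)
    apply Groebner_Basis.algebra
    done
qed

text \<open>The words in \<open>aw_Q\<close> involve \<open>f\<close> from \<open>k - 2\<close> to
  \<open>k + 2\<close>; the contributions away from \<open>k\<close> cancel and the one at
  \<open>k\<close> is the constant \<open>aw_Q0\<close>. The constants \<open>t1\<close> to
  \<open>t4\<close> are the elementary symmetric polynomials of \<open>a\<close>, \<open>b\<close>,
  \<open>c\<close>, \<open>d\<close>.\<close>

lemma op_Q:
  defines "t1 \<equiv> a + s1" and "t2 \<equiv> a * s1 + s2" and "t3 \<equiv> a * s2 + s3" and "t4 \<equiv> a * s3"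
  shows "X (D (X (D f))) k - (q\<^sup>2 + 1 + (inverse q)\<^sup>2) * D (X (D (X f))) k
   + (q + inverse q) * D (D (X (X f))) k
   + (q + inverse q) * ((q - inverse q)\<^sup>2 * D (D f) k + inverse q * (q - inverse q)\<^sup>2 * t4 * X (X f) k)
   + (1 - inverse q)\<^sup>2 * (t3 + q * t1) * ((q + 1 + inverse q) * D (X f) k + X (D f) k)
   + (q + 1 + inverse q) * (- ((inverse q ^ 3 * (1 - q)\<^sup>2 * (1 + q) * (t4 + q * t2 + q\<^sup>2)) * D f k)
       - (inverse q ^ 3 * (1 - q)\<^sup>2 * (1 + q) * (t1 * t4 + q * t3)) * X f k)
   = inverse q ^ 4 * (1 - q)\<^sup>2 *
       (q ^ 4 * (t4 - t2) + q ^ 3 * (t1\<^sup>2 - t1 * t3 - 2 * t2) - q\<^sup>2 * (t2 * t4 + 2 * t4 + t2)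
        + q * (t3\<^sup>2 - 2 * t2 * t4 - t1 * t3) + t4 * (1 - t2)) * f k"
proof -
  define y where "y = q powi k"
  have y: "y \<noteq> 0" using q0 by (simp add: y_def)
  note shift = q_powi_shift[of k, folded y_def] add.commute[of 1 k] add.commute[of 2 k]
  show ?thesis
    apply (simp add: D_def X_def)
    apply (simp add: shift eta_expand flip: y_def)
    apply (simp add: lam_def e_expand xdiag_def xoff_def t1_def t2_def t3_def t4_def)
    using y q0 nz(1)
    apply (simp add: divide_simps shift)
    apply Groebner_Basis.algebra
    done
qed

section \<open>The action of the free algebra on sequences\<close>

primrec gen_op :: "gen \<Rightarrow> (int \<Rightarrow> complex) \<Rightarrow> int \<Rightarrow> complex" where
  "gen_op G0 = D"
| "gen_op G1 = X"

definition word_op :: "gen fword \<Rightarrow> (int \<Rightarrow> complex) \<Rightarrow> int \<Rightarrow> complex" where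
  "word_op w = foldr gen_op (letters w)"

definition act :: "free_alg \<Rightarrow> (int \<Rightarrow> complex) \<Rightarrow> int \<Rightarrow> complex" where
  "act x f k = (\<Sum>w\<in>Poly_Mapping.keys x. Poly_Mapping.lookup x w * word_op w f k)"

lemma word_op_0: "word_op 0 f = f"
  by (simp add: word_op_def)

lemma word_op_add: "word_op (v + w) f = word_op v (word_op w f)"
  by (simp add: word_op_def)

lemma gen_op_linear: "gen_op g (\<lambda>i. s * f i + t * h i) = (\<lambda>k. s * gen_op g f k + t * gen_op g h k)"
  by (cases g) (simp_all add: fun_eq_iff D_def X_def algebra_simps)

lemma word_op_linear:
  "word_op w (\<lambda>i. s * f i + t * h i) = (\<lambda>k. s * word_op w f k + t * word_op w h k)"
proof -
  have "foldr gen_op l (\<lambda>i. s * f i + t * h i) = (\<lambda>k. s * foldr gen_op l f k + t * foldr gen_op l h k)" for l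
    by (induction l) (simp_all add: gen_op_linear)
  then show ?thesis by (simp add: word_op_def)
qed

lemma act_linear: "act x (\<lambda>i. s * f i + t * h i) = (\<lambda>k. s * act x f k + t * act x h k)"
  by (simp add: fun_eq_iff act_def word_op_linear sum_distrib_left algebra_simps sum.distrib)

lemma act_scale: "act x (\<lambda>i. s * f i) = (\<lambda>k. s * act x f k)"
  using act_linear[of x s f 0 f] by simp

lemma act_add_right: "act x (\<lambda>i. f i + h i) = (\<lambda>k. act x f k + act x h k)"
  using act_linear[of x 1 f 1 h] by simp

lemma act_superset:
  assumes "finite A" "Poly_Mapping.keys x \<subseteq> A"
  shows "act x f k = (\<Sum>w\<in>A. Poly_Mapping.lookup x w * word_op w f k)"
  unfolding act_def using assms by (intro sum.mono_neutral_left) (auto simp: in_keys_iff)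

lemma act_add: "act (x + y) f k = act x f k + act y f k"
proof -
  let ?A = "Poly_Mapping.keys x \<union> Poly_Mapping.keys y"
  have "act (x + y) f k = (\<Sum>w\<in>?A. Poly_Mapping.lookup (x + y) w * word_op w f k)"
    by (rule act_superset) (auto simp: Poly_Mapping.keys_add)
  also have "\<dots> = (\<Sum>w\<in>?A. Poly_Mapping.lookup x w * word_op w f k)
      + (\<Sum>w\<in>?A. Poly_Mapping.lookup y w * word_op w f k)"
    by (simp add: lookup_add algebra_simps sum.distrib)
  also have "\<dots> = act x f k + act y f k"
    by (simp add: act_superset[of ?A])
  finally show ?thesis .
qed

lemma act_single: "act (Poly_Mapping.single w s) f k = s * word_op w f k"
  by (simp add: act_superset[of "{w}"])

lemma act_0: "act 0 f k = 0"
  by (simp add: act_def)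

lemma act_minus: "act (- x) f k = - act x f k"
  using act_add[of x "- x" f k] by (simp add: act_0 add_eq_0_iff)

lemma act_diff: "act (x - y) f k = act x f k - act y f k"
  using act_add[of x "- y" f k] by (simp add: act_minus)

text \<open>Linearity of the operators makes both sides additive in \<open>x\<close> and in
  \<open>y\<close>, and on words concatenation becomes composition.\<close>

lemma act_mult: "act (x * y) f = act x (act y f)"
proof (induction x rule: poly_mapping_additive_induct)
  case (single w s)
  show ?case
  proof (induction y rule: poly_mapping_additive_induct)
    case (single w' s')
    have "act (Poly_Mapping.single w' s') f = (\<lambda>k. s' * word_op w' f k)"
      by (simp add: fun_eq_iff act_single)
    then show ?case
      by (simp add: fun_eq_iff mult_single act_single word_op_add act_scale)
  next
    case (add y y')
    have "act (y + y') f = (\<lambda>k. act y f k + act y' f k)"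
      by (simp add: fun_eq_iff act_add)
    then show ?case using add by (simp add: fun_eq_iff distrib_left act_add act_add_right)
  qed
next
  case (add x x')
  then show ?case by (simp add: fun_eq_iff distrib_right act_add)
qed

lemma act_cst: "act (cst s) f k = s * f k"
  by (simp add: cst_def act_single word_op_0)

lemma act_one: "act 1 f = f"
  using act_cst[of 1 f] by (simp add: fun_eq_iff cst_1)

lemma act_K0: "act K0 = D" and act_K1: "act K1 = X"
  by (simp_all add: fun_eq_iff K0_def K1_def act_single word_op_def)

lemmas act_simps = act_add act_diff act_mult act_cst act_one act_K0 act_K1

section \<open>The ideal of relations acts by zero\<close>

abbreviation I :: "free_alg set" where "I \<equiv> aw_ideal q a b c d"

interpretation I: ideal I free_ring by (rule ideal_aw_ideal)

lemma I_0: "0 \<in> I"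
  using additive_subgroup.zero_closed[OF I.is_additive_subgroup] by (simp add: free_ring_def)

lemma I_add: "x \<in> I \<Longrightarrow> y \<in> I \<Longrightarrow> x + y \<in> I"
  using additive_subgroup.a_closed[OF I.is_additive_subgroup, of x y] by (simp add: free_ring_def)

lemma I_mult_left: "x \<in> I \<Longrightarrow> y * x \<in> I"
  using I.I_l_closed[of x y] by (simp add: free_ring_def)

lemma I_mult_right: "x \<in> I \<Longrightarrow> x * y \<in> I"
  using I.I_r_closed[of x y] by (simp add: free_ring_def)

lemma I_minus: "x \<in> I \<Longrightarrow> - x \<in> I"
  using I_mult_left[of x "- 1"] by simp

lemma I_diff: "x \<in> I \<Longrightarrow> y \<in> I \<Longrightarrow> x - y \<in> I"
  using I_add[of x "- y"] I_minus by simp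

lemma I_rels: "aw_rel0 q a b c d \<in> I" "aw_rel1 q a b c d \<in> I"
    "aw_Q q a b c d - cst (aw_Q0 q a b c d) \<in> I"
proof -
  let ?S = "{aw_rel0 q a b c d, aw_rel1 q a b c d, aw_Q q a b c d - cst (aw_Q0 q a b c d)}"
  have "?S \<subseteq> I"
    unfolding aw_ideal_def by (rule ring.genideal_self[OF ring_free_ring]) (simp add: free_ring_def)
  then show "aw_rel0 q a b c d \<in> I" "aw_rel1 q a b c d \<in> I"
    "aw_Q q a b c d - cst (aw_Q0 q a b c d) \<in> I" by auto
qed

lemma act_rels: "act (aw_rel0 q a b c d) f k = 0" "act (aw_rel1 q a b c d) f k = 0"
    "act (aw_Q q a b c d - cst (aw_Q0 q a b c d)) f k = 0"
proof -
  show "act (aw_rel0 q a b c d) f k = 0"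
    using op_rel0[of f k]
    by (simp add: aw_rel0_def act_simps power2_eq_square[of K1] aw_B_def aw_C0_def aw_D0_def
        elementary_symmetric)
  show "act (aw_rel1 q a b c d) f k = 0"
    using op_rel1[of f k]
    by (simp add: aw_rel1_def act_simps power2_eq_square[of K0] aw_B_def aw_C1_def aw_D1_def
        elementary_symmetric)
  show "act (aw_Q q a b c d - cst (aw_Q0 q a b c d)) f k = 0"
    using op_Q[of f k]
    by (simp add: aw_Q_def aw_Q0_def Let_def act_simps power2_eq_square[of K0]
       power2_eq_square[of K1] aw_B_def aw_C0_def aw_C1_def aw_D0_def aw_D1_def elementary_symmetric)
qed

text \<open>The elements that annihilate every sequence form a two-sided ideal containing the three
  generators, and \<open>I\<close> is the smallest such ideal.\<close>

lemma act_ideal: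
  assumes "x \<in> I"
  shows "act x f k = 0"
proof -
  let ?N = "{x. \<forall>f k. act x f k = 0}"
  have "ideal ?N free_ring"
  proof (rule idealI[OF ring_free_ring])
    have inv: "inv\<^bsub>add_monoid free_ring\<^esub> x = - x" for x
      using abelian_group.minus_equality[OF ring.is_abelian_group[OF ring_free_ring], of "- x" x]
      by (simp add: free_ring_def a_inv_def)
    show "subgroup ?N (add_monoid free_ring)"
    proof (rule subgroup.intro)
      fix x assume "x \<in> ?N"
      then show "inv\<^bsub>add_monoid free_ring\<^esub> x \<in> ?N"
        unfolding inv by (simp add: act_minus)
    qed (simp_all add: free_ring_def act_add act_0)
  next
    fix x y assume "x \<in> ?N"
    then have "act x f = (\<lambda>k. 0)" for f by (simp add: fun_eq_iff)
    then show "y \<otimes>\<^bsub>free_ring\<^esub> x \<in> ?N" "x \<otimes>\<^bsub>free_ring\<^esub> y \<in> ?N"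
      using act_scale[of y 0] by (auto simp: free_ring_def act_mult)
  qed
  moreover have "{aw_rel0 q a b c d, aw_rel1 q a b c d, aw_Q q a b c d - cst (aw_Q0 q a b c d)} \<subseteq> ?N"
    using act_rels by simp
  ultimately have "I \<subseteq> ?N"
    unfolding aw_ideal_def by (rule ring.genideal_minimal[OF ring_free_ring])
  with assms show ?thesis by blast
qed

section \<open>Reduction to normal form modulo the ideal\<close>

text \<open>The additive group generated by the ideal and the elements of the normal form; the
  polynomial coefficients of the latter make it closed under scalars and left factors \<open>K0\<close>.\<close>

inductive spanned :: "free_alg \<Rightarrow> bool" where
  ideal: "x \<in> I \<Longrightarrow> spanned x"
| power: "spanned (eval0 p * K1 ^ m)"
| power': "spanned (eval0 p * (K1 * K0 * K1 ^ m))"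
| add: "spanned x \<Longrightarrow> spanned y \<Longrightarrow> spanned (x + y)"

lemma spanned_eval0_mult: "spanned x \<Longrightarrow> spanned (eval0 p * x)"
proof (induction rule: spanned.induct)
  case (power r m)
  then show ?case using spanned.power[of "p * r" m] by (simp add: eval0_mult mult.assoc)
next
  case (power' r m)
  then show ?case using spanned.power'[of "p * r" m] by (simp add: eval0_mult mult.assoc)
qed (auto simp: distrib_left intro: spanned.intros I_mult_left)

lemma spanned_cst_mult: "spanned x \<Longrightarrow> spanned (cst s * x)"
  using spanned_eval0_mult[of x "[:s:]"] by (simp add: eval0_const)

lemma spanned_K0_mult: "spanned x \<Longrightarrow> spanned (K0 * x)"
  using spanned_eval0_mult[of x "[:0, 1:]"] by (simp add: eval0_X)

lemma spanned_uminus: "spanned x \<Longrightarrow> spanned (- x)"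
  using spanned_cst_mult[of x "- 1"] by (simp add: cst_uminus cst_1)

lemma spanned_diff: "spanned x \<Longrightarrow> spanned y \<Longrightarrow> spanned (x - y)"
  using spanned.add[of x "- y"] spanned_uminus by simp

lemma spanned_cong: "spanned y \<Longrightarrow> x - y \<in> I \<Longrightarrow> spanned x"
  using spanned.add[of "x - y" y] spanned.ideal by simp

lemma spanned_K1_pow: "spanned (K1 ^ m)"
  using spanned.power[of "[:1:]" m] by (simp add: eval0_const cst_1)

lemma spanned_K1_K0_K1_pow: "spanned (K1 * (K0 * K1 ^ m))"
  using spanned.power'[of "[:1:]" m] by (simp add: eval0_const cst_1 mult.assoc)

lemmas spanned_intros = spanned.add spanned_diff spanned_cst_mult spanned_K0_mult
  spanned_K1_pow spanned_K1_K0_K1_pow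

text \<open>Polynomials in \<open>K0\<close> move to the left of \<open>K1\<close> at the price of a
  term ending in \<open>K1 * K0\<close>. In the induction, appending \<open>K0\<close> creates
  \<open>K1 * K0^2\<close>, which the second relation rewrites.\<close>

lemma K1_eval0:
  "\<exists>p1 p2 p3. K1 * eval0 p - (eval0 p1 + eval0 p2 * K1 + eval0 p3 * (K1 * K0)) \<in> I"
proof (induction p)
  case 0
  show ?case by (rule exI[of _ 0])+ (simp add: I_0)
next
  case (pCons s p)
  then obtain p1 p2 p3 where
    "K1 * eval0 p - (eval0 p1 + eval0 p2 * K1 + eval0 p3 * (K1 * K0)) \<in> I" (is "?x \<in> I") by blast
  define B C1 D1 t2 where "B = aw_B q a b c d" and "C1 = aw_C1 q a b c d"
    and "D1 = aw_D1 q a b c d" and "t2 = q + inverse q"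
  let ?r = "cst t2 * K0 * K1 * K0 - K0^2 * K1 - K1 * K0^2 - (cst B * K0 + cst C1 * K1 + cst D1)"
  have r: "?r \<in> I"
    using I_rels(2) by (simp add: aw_rel1_def B_def C1_def D1_def t2_def)
  \<comment> \<open>Read off from \<open>?x * K0\<close> after replacing \<open>K1 K0^2\<close> by
    \<open>t2 K0 K1 K0 - K0^2 K1 - B K0 - C1 K1 - D1\<close>; the summand \<open>[:s:]\<close> comes
    from \<open>K1 * cst s\<close>.\<close>
  define p1' where "p1' = pCons 0 p1 - p3 * [:D1, B:]"
  define p2' where "p2' = [:s:] - p3 * [:C1, 0, 1:]"
  define p3' where "p3' = p2 + p3 * [:0, t2:]"
  have comm: "K0 * eval0 p = eval0 p * K0"
    by (metis eval0_X eval0_mult mult.commute)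
  have comm1: "K0 * eval0 p1 = eval0 p1 * K0"
    by (metis eval0_X eval0_mult mult.commute)
  have minus: "eval0 (r - r') = eval0 r - eval0 r'" for r r'
    using eval0_add[of r "smult (- 1) r'"] unfolding eval0_smult by (simp add: cst_uminus cst_1)
  have "K1 * eval0 (pCons s p) - (eval0 p1' + eval0 p2' * K1 + eval0 p3' * (K1 * K0))
      = ?x * K0 - eval0 p3 * ?r"
    unfolding p1'_def p2'_def p3'_def minus eval0_add eval0_mult
    by (simp add: eval0_pCons cst_0 cst_1 comm comm1 cst_central[of s] power2_eq_square algebra_simps)
      (simp add: cst_central mult.assoc)
  also have "\<dots> \<in> I"
    by (rule I_diff[OF I_mult_right[OF \<open>?x \<in> I\<close>] I_mult_left[OF r]])
  finally show ?case by blast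
qed

text \<open>\<open>K1_eval0\<close> moves the coefficient past \<open>K1\<close>, so that only
  products with \<open>w\<close> alone have to be reduced.\<close>

lemma spanned_K1_mult_gen:
  assumes "spanned w" "spanned (K1 * w)" "spanned (K1 * (K0 * w))"
  shows "spanned (K1 * (eval0 p * w))"
proof -
  obtain p1 p2 p3 where
    "K1 * eval0 p - (eval0 p1 + eval0 p2 * K1 + eval0 p3 * (K1 * K0)) \<in> I"
    using K1_eval0 by blast
  then have "(K1 * eval0 p - (eval0 p1 + eval0 p2 * K1 + eval0 p3 * (K1 * K0))) * w \<in> I"
    by (rule I_mult_right)
  then have "K1 * (eval0 p * w) - (eval0 p1 * w + eval0 p2 * (K1 * w) + eval0 p3 * (K1 * (K0 * w))) \<in> I"
    by (simp add: algebra_simps)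
  then show ?thesis
    by (rule spanned_cong[rotated]) (intro spanned.add spanned_eval0_mult assms)
qed

text \<open>The first relation solved for \<open>K1^2 * K0\<close>, multiplied by
  \<open>K1 ^ m\<close> on the right.\<close>

lemma spanned_K1_K1_K0_K1_pow: "spanned (K1 * (K1 * (K0 * K1 ^ m)))"
proof (rule spanned_cong)
  define B C0 D0 t2 where "B = aw_B q a b c d" and "C0 = aw_C0 q"
    and "D0 = aw_D0 q a b c d" and "t2 = q + inverse q"
  let ?y = "cst t2 * (K1 * (K0 * K1 ^ Suc m)) - K0 * K1 ^ (Suc (Suc m))
    - (cst B * K1 ^ Suc m + cst C0 * (K0 * K1 ^ m) + cst D0 * K1 ^ m)"
  show "spanned ?y" by (intro spanned_intros)
  have "aw_rel0 q a b c d * - (K1 ^ m) \<in> I" by (rule I_mult_right) (rule I_rels)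
  moreover have "aw_rel0 q a b c d * - (K1 ^ m) = K1 * (K1 * (K0 * K1 ^ m)) - ?y"
    unfolding aw_rel0_def B_def[symmetric] C0_def[symmetric] D0_def[symmetric] t2_def[symmetric]
    by (simp add: algebra_simps power2_eq_square)
  ultimately show "K1 * (K1 * (K0 * K1 ^ m)) - ?y \<in> I" by simp
qed

text \<open>The relation \<open>Q = Q0\<close> solved for \<open>K1 * K0 * K1 * K0\<close>; it keeps
  longer alternating words out of the normal form.\<close>

lemma spanned_K1_K0_K1_K0_K1_pow: "spanned (K1 * (K0 * (K1 * (K0 * K1 ^ m))))"
proof (rule spanned_cong)
  define B C0 C1 D0 D1 t2 t3 t4 Q0 where "B = aw_B q a b c d" and "C0 = aw_C0 q"
    and "C1 = aw_C1 q a b c d" and "D0 = aw_D0 q a b c d" and "D1 = aw_D1 q a b c d"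
    and "t2 = q + inverse q" and "t3 = q^2 + 1 + inverse q ^ 2" and "t4 = q + 1 + inverse q"
    and "Q0 = aw_Q0 q a b c d"
  let ?y = "cst t3 * (K0 * (K1 * (K0 * K1 ^ Suc m))) - cst t2 * (K0 * (K0 * K1 ^ Suc (Suc m)))
    - cst t2 * (cst C0 * (K0 * (K0 * K1 ^ m)) + cst C1 * K1 ^ Suc (Suc m))
    - cst B * (cst t4 * (K0 * K1 ^ Suc m) + K1 * (K0 * K1 ^ m))
    - cst t4 * (cst D0 * (K0 * K1 ^ m) + cst D1 * K1 ^ Suc m) + cst Q0 * K1 ^ m"
  show "spanned ?y" by (intro spanned_intros)
  have "(aw_Q q a b c d - cst (aw_Q0 q a b c d)) * K1 ^ m \<in> I"
    by (rule I_mult_right) (rule I_rels)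
  moreover have "(aw_Q q a b c d - cst (aw_Q0 q a b c d)) * K1 ^ m = K1 * (K0 * (K1 * (K0 * K1 ^ m))) - ?y"
    unfolding aw_Q_def B_def[symmetric] C0_def[symmetric] D0_def[symmetric] t2_def[symmetric]
      C1_def[symmetric] D1_def[symmetric] t3_def[symmetric] t4_def[symmetric] Q0_def[symmetric]
    by (simp add: algebra_simps power2_eq_square)
  ultimately show "K1 * (K0 * (K1 * (K0 * K1 ^ m))) - ?y \<in> I" by simp
qed

text \<open>For \<open>w = K1 ^ m\<close> the required products are normal forms already; for
  \<open>w = K1 * K0 * K1 ^ m\<close> two of them are the reductions just proved.\<close>

lemma spanned_K1_mult: "spanned x \<Longrightarrow> spanned (K1 * x)"
proof (induction rule: spanned.induct)
  case (ideal x)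
  then show ?case by (intro spanned.ideal I_mult_left)
next
  case (power p m)
  show ?case
    using spanned_K1_pow[of "Suc m"] by (intro spanned_K1_mult_gen spanned_intros) simp
next
  case (power' p m)
  show ?case
    by (intro spanned_K1_mult_gen)
      (simp_all add: mult.assoc spanned_intros spanned_K1_K1_K0_K1_pow spanned_K1_K0_K1_K0_K1_pow)
next
  case (add x y)
  then show ?case by (simp add: distrib_left spanned.add)
qed

lemma spanned: "spanned x"
proof (induction x rule: poly_mapping_additive_induct)
  case (single w s)
  obtain l where w: "w = FWord l" by (cases w)
  have "spanned (Poly_Mapping.single (FWord l) 1)"
  proof (induction l)
    case Nil
    then show ?case using spanned_K1_pow[of 0] by (simp flip: zero_fword_def)
  next
    case (Cons g l)
    have "Poly_Mapping.single (FWord (g # l)) 1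
        = (case g of G0 \<Rightarrow> K0 | G1 \<Rightarrow> K1) * Poly_Mapping.single (FWord l) 1"
      by (cases g) (simp_all add: K0_def K1_def mult_single)
    then show ?case using Cons by (cases g) (simp_all add: spanned_K0_mult spanned_K1_mult)
  qed
  moreover have "Poly_Mapping.single w s = cst s * Poly_Mapping.single (FWord l) 1"
    by (simp add: w cst_def mult_single)
  ultimately show ?case by (simp add: spanned_cst_mult)
next
  case (add x y)
  then show ?case by (rule spanned.add)
qed

text \<open>The index \<open>m\<close> counts the letters \<open>K1\<close>: for positive
  \<open>m\<close> both terms contain \<open>m\<close> of them, so they reach the same top index and
  their leading coefficients are compared together.\<close>

definition normal_form :: "(nat \<Rightarrow> complex poly) \<Rightarrow> (nat \<Rightarrow> complex poly) \<Rightarrow> nat \<Rightarrow> free_alg" where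
  "normal_form p r M = (\<Sum>m\<le>M. eval0 (p m) * K1 ^ m + eval0 (r m) * (K1 * K0 * K1 ^ (m - 1)))"

text \<open>The condition \<open>r 0 = 0\<close> discards the junk summand with exponent \<open>0 - 1 = 0\<close>.\<close>

lemma normal_form_exists:
  "\<exists>p r M. r 0 = 0 \<and> x - normal_form p r M \<in> I"
proof -
  \<comment> \<open>Vanishing beyond \<open>M\<close> is carried along so that two normal forms can
    be padded to a common length when they are added.\<close>
  have "\<exists>p r M. r 0 = 0 \<and> (\<forall>m>M. p m = 0 \<and> r m = 0) \<and> x - normal_form p r M \<in> I"
    using spanned[of x]
  proof (induction rule: spanned.induct)
    case (ideal x)
    then show ?case
      by (intro exI[of _ "\<lambda>_. 0"] exI[of _ 0]) (simp add: normal_form_def)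
  next
    case (power p m)
    have "normal_form (\<lambda>i. if i = m then p else 0) (\<lambda>_. 0) m = (\<Sum>i\<le>m. if i = m then eval0 p * K1 ^ m else 0)"
      unfolding normal_form_def by (rule sum.cong) auto
    then show ?case
      by (intro exI[of _ "\<lambda>i. if i = m then p else 0"] exI[of _ "\<lambda>_. 0"] exI[of _ m]) (simp add: I_0)
  next
    case (power' r m)
    have "normal_form (\<lambda>_. 0) (\<lambda>i. if i = Suc m then r else 0) (Suc m)
        = (\<Sum>i\<le>Suc m. if i = Suc m then eval0 r * (K1 * K0 * K1 ^ m) else 0)"
      unfolding normal_form_def by (rule sum.cong) auto
    also have "\<dots> = eval0 r * (K1 * K0 * K1 ^ m)" by (subst sum.delta) auto
    finally show ?case
      by (intro exI[of _ "\<lambda>_. 0"] exI[of _ "\<lambda>i. if i = Suc m then r else 0"] exI[of _ "Suc m"])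
        (simp add: I_0)
  next
    case (add x y)
    have extend: "normal_form p r N = normal_form p r M"
      if "\<forall>m>M. p m = 0 \<and> r m = 0" "M \<le> N" for p r M N
      unfolding normal_form_def using that by (intro sum.mono_neutral_right) auto
    obtain p r M p' r' M' where
      pr: "r 0 = 0" "\<forall>m>M. p m = 0 \<and> r m = 0" "x - normal_form p r M \<in> I" and
      pr': "r' 0 = 0" "\<forall>m>M'. p' m = 0 \<and> r' m = 0" "y - normal_form p' r' M' \<in> I"
      using add.IH by blast
    define N where "N = max M M'"
    have "normal_form (\<lambda>m. p m + p' m) (\<lambda>m. r m + r' m) N = normal_form p r N + normal_form p' r' N"
      unfolding normal_form_def sum.distrib[symmetric]
      by (rule sum.cong) (simp_all add: eval0_add distrib_right)
    also have "\<dots> = normal_form p r M + normal_form p' r' M'"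
      using extend[OF pr(2), of N] extend[OF pr'(2), of N] by (simp add: N_def)
    finally have "x + y - normal_form (\<lambda>m. p m + p' m) (\<lambda>m. r m + r' m) N \<in> I"
      using I_add[OF pr(3) pr'(3)] by (simp add: algebra_simps)
    moreover have "r 0 + r' 0 = 0" "\<forall>m>N. p m + p' m = 0 \<and> r m + r' m = 0"
      using pr(1,2) pr'(1,2) by (auto simp: N_def)
    ultimately show ?case
      by (intro exI[of _ "\<lambda>m. p m + p' m"] exI[of _ "\<lambda>m. r m + r' m"] exI[of _ N]) simp
  qed
  then show ?thesis by blast
qed

section \<open>Leading coefficients and faithfulness\<close>

lemma e_nz: "e \<noteq> 0"
  using nz q0 by (simp add: e_def)

lemma q_powi_eq_iff: "q powi i = q powi j \<longleftrightarrow> i = j"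
proof -
  have "i \<ge> j" if eq: "q powi i = q powi j" for i j
  proof (rule ccontr)
    assume less: "\<not> i \<ge> j"
    have "q powi (j - i) = 1"
      using eq q0 by (simp add: power_int_diff)
    then have "q ^ nat (j - i) = 1"
      using less by (simp add: power_int_def split: if_splits)
    then show False using q_root[of "nat (j - i)"] less by simp
  qed
  then show ?thesis by (metis order_antisym)
qed

text \<open>For \<open>k > 0\<close> and \<open>y = q ^ (k - 1)\<close>, the difference times
  \<open>q y\<close> factors as \<open>(q y - 1) (a b c d y - 1)\<close>. A zero would make
  \<open>q\<close> a root of unity or \<open>a b c d\<close> a power of
  \<open>inverse q\<close>.\<close>

lemma lam_eq_iff:
  assumes "k \<ge> 0"
  shows "lam (q powi k) = lam 1 \<longleftrightarrow> k = 0"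
proof
  assume eq: "lam (q powi k) = lam 1"
  show "k = 0"
  proof (rule ccontr)
    assume "k \<noteq> 0"
    define m where "m = nat (k - 1)"
    have k: "k = int (Suc m)" using assms \<open>k \<noteq> 0\<close> by (simp add: m_def)
    define y where "y = q ^ m"
    have y: "q powi k = q * y" "y \<noteq> 0" using q0 unfolding k power_int_of_nat by (simp_all add: y_def)
    have "q * y \<noteq> 1" using q_root[of "Suc m"] by (simp add: y_def)
    moreover have "(q * y - 1) * (a * b * c * d * y - 1) = 0"
    proof -
      have "q * y * (lam (q * y) - lam 1) = (q * y - 1) * (a * b * c * d * y - 1)"
        using y(2) q0 unfolding lam_def e_def by (simp add: field_simps)
      then show ?thesis using eq y(1) by simp
    qed
    ultimately have "a * b * c * d * y = 1" by simp
    then have "a * b * c * d = inverse y"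
      by (metis inverse_unique mult.commute)
    then show False using e4_nz[of m] by (simp add: y_def power_inverse)
  qed
qed simp

definition delta :: "int \<Rightarrow> int \<Rightarrow> complex" where
  "delta k i = (if i = k then 1 else 0)"

text \<open>A filtration by top index: \<open>D\<close> preserves it and \<open>X\<close> raises it
  by one, multiplying the leading coefficient by \<open>lam\<close> and \<open>xoff\<close>
  respectively.\<close>

definition bounded_by :: "int \<Rightarrow> (int \<Rightarrow> complex) \<Rightarrow> bool" where
  "bounded_by j f \<longleftrightarrow> (\<forall>i>j. f i = 0)"

lemma bounded_by_X: "bounded_by j f \<Longrightarrow> bounded_by (j + 1) (X f)"
  by (simp add: bounded_by_def X_def)

lemma X_top: "bounded_by j f \<Longrightarrow> X f (j + 1) = xoff (q powi j) * f j"
  by (simp add: bounded_by_def X_def)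

lemma bounded_by_D: "bounded_by j f \<Longrightarrow> bounded_by j (D f)"
  by (simp add: bounded_by_def D_def)

lemma D_top: "bounded_by j f \<Longrightarrow> D f j = lam (q powi j) * f j"
  by (simp add: bounded_by_def D_def)

lemma xoff_nz: "xoff (q powi j) \<noteq> 0"
  using nz q0 by (simp add: xoff_def)

lemma X_pow_delta: "bounded_by (k + int m) (act (K1 ^ m) (delta k)) \<and> act (K1 ^ m) (delta k) (k + int m) \<noteq> 0"
proof (induction m)
  case 0
  then show ?case by (simp add: act_one bounded_by_def delta_def)
next
  case (Suc m)
  let ?f = "act (K1 ^ m) (delta k)"
  have "act (K1 ^ Suc m) (delta k) = X ?f" "k + int (Suc m) = k + int m + 1"
    by (simp_all add: act_mult act_K1)
  moreover have "bounded_by (k + int m + 1) (X ?f)" "X ?f (k + int m + 1) \<noteq> 0"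
    using Suc xoff_nz by (simp_all add: bounded_by_X X_top)
  ultimately show ?case by metis
qed

lemma eval0_act:
  assumes "bounded_by j f"
  shows "bounded_by j (act (eval0 p) f) \<and> act (eval0 p) f j = poly p (lam (q powi j)) * f j"
proof (induction p)
  case 0
  then show ?case by (simp add: bounded_by_def act_0)
next
  case (pCons s p)
  have "act (eval0 (pCons s p)) f = (\<lambda>k. s * f k + D (act (eval0 p) f) k)"
    by (simp add: fun_eq_iff eval0_pCons act_simps)
  then show ?case
    using pCons assms bounded_by_D[of j "act (eval0 p) f"] D_top[of j "act (eval0 p) f"]
    by (simp add: bounded_by_def algebra_simps)
qed

text \<open>Only the summand \<open>m = M\<close> reaches index \<open>k + M\<close>. In its second
  term \<open>K0\<close> acts before the last \<open>K1\<close> is applied, hence the eigenvalue at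
  \<open>k + M - 1\<close>; the factor \<open>t\<close> collects the values of \<open>xoff\<close>
  and is shared by both terms.\<close>

lemma act_normal_form_top:
  assumes "r 0 = 0"
  shows "bounded_by (k + int M) (act (normal_form p r M) (delta k)) \<and>
    (\<exists>t. t \<noteq> 0 \<and> act (normal_form p r M) (delta k) (k + int M)
      = t * (poly (p M) (lam (q powi (k + int M)))
           + poly (r M) (lam (q powi (k + int M))) * lam (q powi (k + int M - 1))))"
proof (induction M)
  case 0
  have "bounded_by k (delta k)" "delta k k = 1"
    by (simp_all add: bounded_by_def delta_def)
  then show ?case
    using eval0_act[of k "delta k" "p 0"] assms
    by (intro conjI exI[of _ 1]) (simp_all add: normal_form_def)
next
  case (Suc n)
  define g where "g = act (K1 ^ n) (delta k)"
  let ?j = "k + int n"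
  have g: "bounded_by ?j g" "g ?j \<noteq> 0"
    using X_pow_delta unfolding g_def by auto
  have 1: "bounded_by (?j + 1) (X g)" "X g (?j + 1) = xoff (q powi ?j) * g ?j"
    "bounded_by (?j + 1) (X (D g))" "X (D g) (?j + 1) = xoff (q powi ?j) * (lam (q powi ?j) * g ?j)"
    using g by (simp_all add: bounded_by_X X_top bounded_by_D D_top)
  have "act (normal_form p r (Suc n)) (delta k) i = act (normal_form p r n) (delta k) i
     + act (eval0 (p (Suc n))) (X g) i + act (eval0 (r (Suc n))) (X (D g)) i" for i
    by (simp add: normal_form_def act_simps g_def)
  moreover have "bounded_by ?j (act (normal_form p r n) (delta k))"
    using Suc by blast
  moreover have "xoff (q powi ?j) * g ?j \<noteq> 0"
    using g(2) xoff_nz by simp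
  ultimately show ?case
    using eval0_act[OF 1(1), of "p (Suc n)"] eval0_act[OF 1(3), of "r (Suc n)"] 1(2,4)
    by (intro conjI exI[of _ "xoff (q powi ?j) * g ?j"]) (simp_all add: bounded_by_def algebra_simps)
qed

text \<open>As \<open>k\<close> varies, \<open>y = q powi (k + M)\<close> takes infinitely many
  values, and \<open>lam (y / q)\<close> is the second Laurent polynomial in
  \<open>poly_pair_eq_0\<close>.\<close>

lemma act_normal_form_eq_0_top:
  assumes "r 0 = 0" and zero: "\<And>k i. k \<ge> 0 \<Longrightarrow> act (normal_form p r M) (delta k) i = 0"
  shows "p M = 0 \<and> r M = 0"
proof (rule poly_pair_eq_0)
  let ?Y = "(\<lambda>k. q powi (k + int M)) ` {0..}"
  have "inj_on (\<lambda>k. q powi (k + int M)) {0..}"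
    by (simp add: inj_on_def q_powi_eq_iff)
  then show "infinite ?Y"
    using infinite_Ici[of "0 :: int"] by (simp add: finite_image_iff)
  show "0 \<notin> ?Y" using q0 by auto
  show "q\<^sup>2 \<noteq> 1" using q_root[of 2] by simp
  show "poly (p M) (1 / y + e * y) + poly (r M) (1 / y + e * y) * (q / y + e * y / q) = 0"
    if y: "y \<in> ?Y" for y
  proof -
    obtain k where k: "k \<ge> 0" "y = q powi (k + int M)" using y by auto
    have "q powi (k + int M - 1) = y / q" using q0 by (simp add: k power_int_diff)
    then show ?thesis
      using act_normal_form_top[of r k M p] assms(1) zero[OF k(1), of "k + int M"] k(2)
      by (auto simp: lam_def)
  qed
qed (use e_nz q0 in auto)

text \<open>Faithfulness of the representation, tested on the invariant subspace \<open>k \<ge> 0\<close> only.\<close>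

lemma act_delta_eq_0_imp_ideal:
  assumes "\<And>k i. k \<ge> 0 \<Longrightarrow> act x (delta k) i = 0"
  shows "x \<in> I"
proof -
  obtain p r M where pr: "r 0 = 0" "x - normal_form p r M \<in> I"
    using normal_form_exists by blast
  have "act (normal_form p r M) (delta k) i = 0" if "k \<ge> 0" for k i
    using act_ideal[OF pr(2), of "delta k" i] assms[OF that, of i] by (simp add: act_diff)
  then have "normal_form p r M = 0"
  proof (induction M)
    case 0
    have "p 0 = 0"
      using act_normal_form_eq_0_top[OF pr(1) 0] by blast
    then show ?case by (simp add: normal_form_def pr(1))
  next
    case (Suc M)
    have "p (Suc M) = 0 \<and> r (Suc M) = 0"
      by (rule act_normal_form_eq_0_top[OF pr(1) Suc.prems])
    then have eq: "normal_form p r (Suc M) = normal_form p r M"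
      by (simp add: normal_form_def)
    have "normal_form p r M = 0"
      by (rule Suc.IH) (use Suc.prems in \<open>simp only: eq\<close>)
    with eq show ?case by simp
  qed
  then show ?thesis using pr(2) by simp
qed

section \<open>Central elements act as scalars\<close>

text \<open>The span of \<open>delta k\<close> for \<open>k \<ge> 0\<close>, a copy of the
  polynomial module.\<close>

definition finitely_supported :: "(int \<Rightarrow> complex) \<Rightarrow> bool" where
  "finitely_supported f \<longleftrightarrow> (\<forall>k<0. f k = 0) \<and> (\<exists>N. bounded_by N f)"

lemma finitely_supported_D: "finitely_supported f \<Longrightarrow> finitely_supported (D f)"
proof -
  assume f: "finitely_supported f"
  have "D f k = 0" if "k < 0" for k
    \<comment> \<open>At \<open>k = -1\<close> the only contribution is \<open>eta 1 * f 0\<close>,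
      and \<open>eta 1 = 0\<close>.\<close>
    using f that by (cases "k = -1") (auto simp: finitely_supported_def D_def eta_def)
  then show ?thesis using f bounded_by_D unfolding finitely_supported_def by blast
qed

lemma finitely_supported_X: "finitely_supported f \<Longrightarrow> finitely_supported (X f)"
  using bounded_by_X unfolding finitely_supported_def by (auto simp: X_def)

lemma finitely_supported_act:
  assumes "finitely_supported f"
  shows "finitely_supported (act x f)"
proof (induction x rule: poly_mapping_additive_induct)
  case (single w s)
  have "finitely_supported (gen_op g f)" if "finitely_supported f" for f g
    using that by (cases g) (simp_all add: finitely_supported_D finitely_supported_X)
  then have "finitely_supported (foldr gen_op l f)" for l
    using assms by (induction l) auto
  then have "finitely_supported (word_op w f)"
    by (simp add: word_op_def)
  then show ?case
    by (auto simp: finitely_supported_def bounded_by_def act_single)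
next
  case (add x y)
  then obtain N N' where "bounded_by N (act x f)" "bounded_by N' (act y f)"
    unfolding finitely_supported_def by blast
  then have "bounded_by (max N N') (act (x + y) f)"
    by (simp add: bounded_by_def act_add)
  moreover have "act (x + y) f k = 0" if "k < 0" for k
    using add that by (simp add: finitely_supported_def act_add)
  ultimately show ?case unfolding finitely_supported_def by blast
qed

text \<open>At the largest positive index \<open>j\<close> of the support, \<open>D\<close>
  multiplies the coefficient by \<open>lam (q powi j)\<close>, which differs from
  \<open>lam 1\<close>; so no such index exists.\<close>

lemma finitely_supported_eigenvector:
  assumes f: "finitely_supported f" and D: "D f = (\<lambda>k. lam 1 * f k)" and "k \<noteq> 0"
  shows "f k = 0"
proof (rule ccontr)
  assume "f k \<noteq> 0"
  obtain N where N: "bounded_by N f" using f unfolding finitely_supported_def by blast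
  define S where "S = {i. i > 0 \<and> f i \<noteq> 0}"
  have "k \<in> S" using \<open>f k \<noteq> 0\<close> \<open>k \<noteq> 0\<close> f unfolding S_def finitely_supported_def
    by (cases "k < 0") auto
  have "S \<subseteq> {0..N}"
    using N unfolding S_def bounded_by_def by (auto simp: not_le[symmetric])
  then have "finite S" using finite_subset by blast
  define j where "j = Max S"
  have j: "j \<in> S" "\<And>i. i \<in> S \<Longrightarrow> i \<le> j"
    using Max_in[OF \<open>finite S\<close>] Max_ge[OF \<open>finite S\<close>] \<open>k \<in> S\<close> unfolding j_def by auto
  have "bounded_by j f"
    unfolding bounded_by_def
  proof (intro allI impI)
    fix i assume "j < i"
    moreover have "j > 0" using j(1) by (simp add: S_def)
    ultimately have "i \<notin> S" "i > 0" using j(2)[of i] by auto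
    then show "f i = 0" by (simp add: S_def)
  qed
  then have "lam (q powi j) * f j = lam 1 * f j"
    using D_top D by metis
  then show False using j(1) lam_eq_iff[of j] by (auto simp: S_def)
qed

text \<open>Among finitely supported sequences, the eigenvectors of \<open>D\<close> for
  \<open>lam 1\<close> are multiples of \<open>delta 0\<close>, and the action of \<open>x\<close>
  preserves this line. Subtracting the scalar leaves an element that kills
  \<open>delta 0\<close>.\<close>

lemma central_imp_scalar:
  assumes central: "\<And>y. x * y - y * x \<in> I"
  obtains s where "x - cst s \<in> I"
proof -
  have comm: "act x (act y f) = act y (act x f)" for y f
    using act_ideal[OF central[of y], of f] by (simp add: fun_eq_iff act_diff act_mult)
  define s where "s = act x (delta 0) 0"
  define z where "z = x - cst s"
  have "D (delta 0) = (\<lambda>k. lam 1 * delta 0 k)"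
  proof
    show "D (delta 0) k = lam 1 * delta 0 k" for k
      by (cases "k = -1") (auto simp: D_def delta_def eta_def)
  qed
  then have "D (act x (delta 0)) = (\<lambda>k. lam 1 * act x (delta 0) k)"
    using comm[of K0 "delta 0"] by (simp add: act_K0 act_scale)
  moreover have "finitely_supported (act x (delta 0))"
    by (rule finitely_supported_act) (auto simp: finitely_supported_def bounded_by_def delta_def)
  ultimately have "act x (delta 0) k = 0" if "k \<noteq> 0" for k
    using finitely_supported_eigenvector that by blast
  then have z0: "act z (delta 0) = (\<lambda>k. 0)"
    by (auto simp: fun_eq_iff z_def act_diff act_cst s_def delta_def)
  have z_comm: "act z (X f) = X (act z f)" for f
  proof -
    have "z * K1 - K1 * z = x * K1 - K1 * x"
      unfolding z_def by (simp add: algebra_simps cst_central)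
    then have "z * K1 - K1 * z \<in> I" using central by simp
    from act_ideal[OF this, of f] show ?thesis
      by (simp add: fun_eq_iff act_diff act_mult act_K1)
  qed
  have z_nat: "act z (delta (int n)) = (\<lambda>k. 0)" for n
  proof (induction n)
    case 0
    then show ?case using z0 by simp
  next
    case (Suc n)
    define \<alpha> \<beta> where "\<alpha> = xdiag (q powi int n)" and "\<beta> = xoff (q powi int n)"
    have "\<beta> \<noteq> 0" unfolding \<beta>_def by (rule xoff_nz)
    \<comment> \<open>The two-term formula for \<open>X (delta (int n))\<close>, solved for the next
      basis vector; commuting with \<open>X\<close> then carries the vanishing from \<open>n\<close>
      to \<open>n + 1\<close>.\<close>
    have "delta (int (Suc n)) = (\<lambda>k. 1 / \<beta> * X (delta (int n)) k + (- \<alpha> / \<beta>) * delta (int n) k)"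
      using \<open>\<beta> \<noteq> 0\<close> by (auto simp: fun_eq_iff X_def delta_def \<alpha>_def \<beta>_def)
    then have "act z (delta (int (Suc n)))
        = (\<lambda>k. 1 / \<beta> * act z (X (delta (int n))) k + (- \<alpha> / \<beta>) * act z (delta (int n)) k)"
      by (simp only: act_linear)
    then show ?case using Suc by (simp add: z_comm X_def)
  qed
  have "act z (delta k) i = 0" if "k \<ge> 0" for k i
    using z_nat[of "nat k"] that by simp
  then have "z \<in> I" by (rule act_delta_eq_0_imp_ideal)
  then show thesis using that unfolding z_def by blast
qed

section \<open>Passage to the quotient ring\<close>

lemma AW_simps:
  "carrier (AW q a b c d) = range (\<lambda>x. I +>\<^bsub>free_ring\<^esub> x)"
  "(I +>\<^bsub>free_ring\<^esub> x) \<otimes>\<^bsub>AW q a b c d\<^esub> (I +>\<^bsub>free_ring\<^esub> y) = I +>\<^bsub>free_ring\<^esub> (x * y)"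
proof -
  show "carrier (AW q a b c d) = range (\<lambda>x. I +>\<^bsub>free_ring\<^esub> x)"
    by (auto simp: AW_def FactRing_def A_RCOSETS_def' free_ring_def)
  show "(I +>\<^bsub>free_ring\<^esub> x) \<otimes>\<^bsub>AW q a b c d\<^esub> (I +>\<^bsub>free_ring\<^esub> y) = I +>\<^bsub>free_ring\<^esub> (x * y)"
    using I.rcoset_mult_add[of x y] by (simp add: AW_def FactRing_def free_ring_def)
qed

lemma coset_eq_iff: "I +>\<^bsub>free_ring\<^esub> x = I +>\<^bsub>free_ring\<^esub> y \<longleftrightarrow> x - y \<in> I"
proof -
  have "\<ominus>\<^bsub>free_ring\<^esub> y = - y"
    using abelian_group.minus_equality[OF ring.is_abelian_group[OF ring_free_ring], of "- y" y]
    by (simp add: free_ring_def)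
  then have "x \<ominus>\<^bsub>free_ring\<^esub> y = x - y"
    by (simp add: a_minus_def) (simp add: free_ring_def)
  then show ?thesis
    using ring.quotient_eq_iff_same_a_r_cos[OF ring_free_ring ideal_aw_ideal, of x y]
    by (simp add: free_ring_def)
qed

text \<open>A coset is central exactly when all commutators with a representative lie in
  \<open>I\<close>; scalars are central already in the free algebra.\<close>

lemma ring_center_AW: "ring_center (AW q a b c d) = range (aw_scalar q a b c d)"
proof (intro equalityI subsetI)
  fix Z assume Z: "Z \<in> ring_center (AW q a b c d)"
  then obtain x where x: "Z = I +>\<^bsub>free_ring\<^esub> x"
    by (auto simp: ring_center_def AW_simps)
  have "x * y - y * x \<in> I" for y
    using Z by (simp add: x ring_center_def AW_simps coset_eq_iff)
  then obtain s where "x - cst s \<in> I" using central_imp_scalar by blast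
  then show "Z \<in> range (aw_scalar q a b c d)"
    by (auto simp: x aw_scalar_def coset_eq_iff)
next
  fix Z assume "Z \<in> range (aw_scalar q a b c d)"
  then show "Z \<in> ring_center (AW q a b c d)"
    by (auto simp: aw_scalar_def ring_center_def AW_simps coset_eq_iff cst_central I_0)
qed

end

theorem theorem5p2:
  fixes q a b c d :: complex
  assumes "q \<noteq> 0"
    and "\<And>m::nat. m \<ge> 1 \<Longrightarrow> q ^ m \<noteq> 1"
    and "a \<noteq> 0" "b \<noteq> 0" "c \<noteq> 0" "d \<noteq> 0"
    and "\<And>m::nat. a * b * c * d \<noteq> inverse q ^ m"
    and "a * b \<noteq> 1"
  shows "ring_center (AW q a b c d) = range (aw_scalar q a b c d)"
proof -
  interpret askey_wilson_params q a b c d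
    using assms by unfold_locales auto
  show ?thesis by (rule ring_center_AW)
qed

end
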